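(* Let $G(V,E)$ be a graph. If there is a vertex $v\in V$ with degree $d(v)=\frac{|E|}{2}$, then $G$ is balanceable.
   Context: All graphs are simple and finite. A 2-coloring of the edges of $K_n$ is a function $\alpha:E(K_n)\to\{R,B\}$. It contains a balanced copy of a graph $G$ if $K_n$ has a (not necessarily induced) subgraph isomorphic to $G$ whose edge set is partitioned into $E_1,E_2$ with $\alpha(e)=R$ for $e\in E_1$, $\alpha(e)=B$ for $e\in E_2$, and $\big||E_1|-|E_2|\big|\le 1$. A graph $G$ is balanceable if there is an $n_0$ such that for every $n\ge n_0$ there exists an integer $m$ with $0\le m<\lfloor \frac12\binom n2\rfloor$ such that every 2-coloring $\alpha$ of $E(K_n)$ with $|\alpha^{-1}(R)|>m$ and $|\alpha^{-1}(B)|>m$ contains a balanced copy of $G$. *)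

theory Defs
  imports Complex_Main "HOL-Library.Ramsey"
begin

text \<open>
  A graph is given by its vertex set and its edge set; edges are two-element sets of vertices,
  so there are no loops and no multiple edges. \<open>[V]\<^bsup>2\<^esup>\<close> is the set of two-element subsets of \<open>V\<close>.
\<close>

definition simple_graph :: "'a set \<Rightarrow> 'a set set \<Rightarrow> bool" where
  "simple_graph V E \<longleftrightarrow> finite V \<and> E \<subseteq> [V]\<^bsup>2\<^esup>"

definition vertex_degree :: "'a set set \<Rightarrow> 'a \<Rightarrow> nat" where
  "vertex_degree E v = card {e \<in> E. v \<in> e}"

definition subgraph :: "'a set \<Rightarrow> 'a set set \<Rightarrow> 'a set \<Rightarrow> 'a set set \<Rightarrow> bool" where
  "subgraph W F V E \<longleftrightarrow> simple_graph W F \<and> W \<subseteq> V \<and> F \<subseteq> E"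

definition graph_isomorphic :: "'a set \<Rightarrow> 'a set set \<Rightarrow> 'b set \<Rightarrow> 'b set set \<Rightarrow> bool" where
  "graph_isomorphic V E W F \<longleftrightarrow>
     (\<exists>f. bij_betw f V W \<and> (\<forall>u\<in>V. \<forall>v\<in>V. {u, v} \<in> E \<longleftrightarrow> {f u, f v} \<in> F))"

definition complete_edges :: "nat \<Rightarrow> nat set set" where
  "complete_edges n = [{..<n}]\<^bsup>2\<^esup>"

datatype color = Red | Blue

text \<open>
  A 2-coloring of \<open>K\<^sub>n\<close> is represented by a total function on sets of naturals, of which only the
  values on \<open>complete_edges n\<close> matter.
\<close>

definition color_class :: "nat \<Rightarrow> (nat set \<Rightarrow> color) \<Rightarrow> color \<Rightarrow> nat set set" where
  "color_class n \<alpha> c = {e \<in> complete_edges n. \<alpha> e = c}"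

definition contains_balanced_copy ::
    "nat \<Rightarrow> (nat set \<Rightarrow> color) \<Rightarrow> 'a set \<Rightarrow> 'a set set \<Rightarrow> bool" where
  "contains_balanced_copy n \<alpha> V E \<longleftrightarrow>
     (\<exists>W F E1 E2. subgraph W F {..<n} (complete_edges n) \<and> graph_isomorphic V E W F \<and>
        F = E1 \<union> E2 \<and> E1 \<inter> E2 = {} \<and>
        (\<forall>e\<in>E1. \<alpha> e = Red) \<and> (\<forall>e\<in>E2. \<alpha> e = Blue) \<and>
        \<bar>int (card E1) - int (card E2)\<bar> \<le> 1)"

definition balanceable :: "'a set \<Rightarrow> 'a set set \<Rightarrow> bool" where
  "balanceable V E \<longleftrightarrow>
     (\<exists>n0. \<forall>n\<ge>n0. \<exists>m::nat. m < (n choose 2) div 2 \<and>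
        (\<forall>\<alpha>. card (color_class n \<alpha> Red) > m \<and> card (color_class n \<alpha> Blue) > m \<longrightarrow>
              contains_balanced_copy n \<alpha> V E))"

end

theory Submission
  imports Defs
begin

text \<open>
  If the vertex \<open>v\<close> carries half of the edges, then a balanced copy of the graph arises from any
  monochromatic clique together with a further vertex joined to it entirely in the other color
  (a \<open>two_colored_cone\<close>): put \<open>v\<close> at the apex and the remaining vertices into the clique. As soon as
  both colors have more than linearly many edges, each color \<open>c\<close> has a vertex with a large
  \<open>c\<close>-neighborhood; by Ramsey's theorem this neighborhood contains either a cone base of the other
  color or a large \<open>c\<close>-clique. In the remaining case there are a large red clique \<open>S\<close> and a large blue
  clique \<open>T\<close>. If no vertex of \<open>T\<close> is the apex of a cone over a red base in \<open>S\<close>, then every vertex of \<open>T\<close>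
  sends few blue edges to \<open>S\<close>, so some vertex of \<open>S\<close> sends only red edges to many vertices of \<open>T\<close>
  and is the apex of a cone over a blue base.
\<close>

text \<open>The clique color \<open>c\<close> is existential because the search for a cone may end
  in either color. Avoiding \<open>c\<close> on the edges at the apex \<open>x\<close> amounts to
  having the other color there.\<close>

definition two_colored_cone :: "nat \<Rightarrow> (nat set \<Rightarrow> color) \<Rightarrow> nat \<Rightarrow> bool" where
  "two_colored_cone n \<alpha> k \<longleftrightarrow>
     (\<exists>c x A. x < n \<and> A \<subseteq> {..<n} \<and> x \<notin> A \<and> card A = k \<and>
        clique A {e. \<alpha> e = c} \<and> (\<forall>a\<in>A. \<alpha> {x, a} \<noteq> c))"

lemma color_neq_trans:
  fixes a b c :: color
  assumes "a \<noteq> c" "b \<noteq> c"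
  shows "a = b"
  using assms by (metis color.exhaust)

lemma two_colored_coneI:
  assumes "x < n" "A \<subseteq> {..<n}" "x \<notin> A" "k \<le> card A"
    and "clique A {e. \<alpha> e = c}" "\<And>a. a \<in> A \<Longrightarrow> \<alpha> {x, a} \<noteq> c"
  shows "two_colored_cone n \<alpha> k"
proof -
  obtain B where B: "B \<subseteq> A" "card B = k"
    using obtain_subset_with_card_n[OF assms(4)] by metis
  have "clique B {e. \<alpha> e = c}"
    using assms(5) B(1) by (rule smaller_clique)
  moreover have "B \<subseteq> {..<n}" "x \<notin> B" "\<forall>a\<in>B. \<alpha> {x, a} \<noteq> c"
    using assms B(1) by auto
  ultimately show ?thesis
    unfolding two_colored_cone_def using assms(1) B(2) by blast
qed

lemma two_colored_cone_if_large_cliques: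
  assumes S: "S \<subseteq> {..<n}" "card S \<ge> k * k + k + 1" "clique S {e. \<alpha> e = c}"
    and T: "T \<subseteq> {..<n}" "card T \<ge> k + 1" "clique T {e. \<alpha> e = d}"
    and "c \<noteq> d"
  shows "two_colored_cone n \<alpha> k"
proof (rule ccontr)
  assume no_cone: "\<not> ?thesis"
  have fin: "finite S" "finite T"
    using S(1) T(1) finite_subset by blast+
  \<comment> \<open>An edge inside both cliques would have two colors. An apex must lie outside its
    base, so one possibly shared vertex is discarded; this is why \<open>T\<close> has at least
    \<open>k + 1\<close> vertices.\<close>
  have "card (S \<inter> T) \<le> 1"
  proof (rule ccontr)
    assume "\<not> card (S \<inter> T) \<le> 1"
    then obtain x y where xy: "x \<in> S \<inter> T" "y \<in> S \<inter> T" "x \<noteq> y"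
      using card_le_Suc0_iff_eq[of "S \<inter> T"] fin(1) by auto
    then have "\<alpha> {x, y} = c"
      using S(3) by (simp add: clique_def)
    moreover have "\<alpha> {x, y} = d"
      using xy T(3) by (simp add: clique_def)
    ultimately show False
      using \<open>c \<noteq> d\<close> by simp
  qed
  then have "card (T - S) \<ge> k"
    using T(2) fin card_Diff_subset_Int[of T S] by (simp add: Int_commute)
  then obtain T' where T': "T' \<subseteq> T - S" "card T' = k" "finite T'"
    using obtain_subset_with_card_n by metis
  define N where "N t = {s \<in> S. \<alpha> {t, s} \<noteq> c}" for t
  have N_le: "card (N t) \<le> k" if "t \<in> T'" for t
  proof (rule ccontr)
    assume large: "\<not> card (N t) \<le> k"
    have "two_colored_cone n \<alpha> k"
    proof (rule two_colored_coneI)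
      show "t < n" "N t \<subseteq> {..<n}" "t \<notin> N t" "k \<le> card (N t)"
        using that large T'(1) S(1) T(1) by (auto simp: N_def)
      show "clique (N t) {e. \<alpha> e = c}"
        using S(3) by (rule smaller_clique) (simp add: N_def)
      show "\<alpha> {t, s} \<noteq> c" if "s \<in> N t" for s
        using that by (simp add: N_def)
    qed
    then show False
      using no_cone by contradiction
  qed
  \<comment> \<open>Each of the \<open>k\<close> vertices of \<open>T'\<close> rules out at most
    \<open>k\<close> vertices of \<open>S\<close>. More than \<open>k * k\<close> vertices in
    \<open>S\<close> therefore leave one that is joined to all of \<open>T'\<close> in color
    \<open>c\<close>.\<close>
  have "card (\<Union>t\<in>T'. N t) \<le> (\<Sum>t\<in>T'. card (N t))"
    by (rule card_UN_le) (fact T'(3))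
  also have "\<dots> \<le> k * k"
    using sum_bounded_above[of T' "\<lambda>t. card (N t)" k] N_le T'(2) by simp
  finally have "card (\<Union>t\<in>T'. N t) < card S"
    using S(2) by simp
  moreover have "finite (\<Union>t\<in>T'. N t)"
    using T'(3) fin by (simp add: N_def)
  ultimately have "\<not> S \<subseteq> (\<Union>t\<in>T'. N t)"
    by (meson card_mono leD)
  then obtain s where s: "s \<in> S" "\<And>t. t \<in> T' \<Longrightarrow> \<alpha> {t, s} = c"
    by (auto simp: N_def)
  have "two_colored_cone n \<alpha> k"
  proof (rule two_colored_coneI)
    show "s < n" "T' \<subseteq> {..<n}" "s \<notin> T'" "k \<le> card T'"
      using s(1) S(1) T(1) T' by auto
    show "clique T' {e. \<alpha> e = d}"
      using T(3) by (rule smaller_clique) (use T'(1) in auto)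
    show "\<alpha> {s, t} \<noteq> d" if "t \<in> T'" for t
      using s(2)[OF that] \<open>c \<noteq> d\<close> by (simp add: insert_commute)
  qed
  then show False
    using no_cone by contradiction
qed

text \<open>Every edge of color \<open>c\<close> comes from an ordered pair of an endpoint and a
  neighbor of it in that color, so small neighborhoods allow at most \<open>n * r\<close> such
  edges. Each edge arises from two pairs; losing this factor is harmless, since any bound linear in
  \<open>n\<close> suffices.\<close>

lemma large_color_class_large_neighborhood:
  assumes "card (color_class n \<alpha> c) > n * r"
  shows "\<exists>x<n. card {y \<in> {..<n} - {x}. \<alpha> {x, y} = c} \<ge> r"
proof (rule ccontr)
  assume no_vertex: "\<not> ?thesis"
  define N where "N x = {y \<in> {..<n} - {x}. \<alpha> {x, y} = c}" for x
  have N_le: "card (N x) \<le> r" if "x < n" for x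
    using no_vertex that by (auto simp: N_def)
  have "color_class n \<alpha> c \<subseteq> (\<lambda>(x, y). {x, y}) ` (SIGMA x:{..<n}. N x)"
  proof
    fix e assume "e \<in> color_class n \<alpha> c"
    then obtain x y where "e = {x, y}" "x < n" "y < n" "x \<noteq> y" "\<alpha> e = c"
      unfolding color_class_def complete_edges_def by (auto elim!: nsets2_E)
    then show "e \<in> (\<lambda>(x, y). {x, y}) ` (SIGMA x:{..<n}. N x)"
      by (auto simp: N_def intro!: image_eqI[where x = "(x, y)"])
  qed
  moreover have fin: "finite (SIGMA x:{..<n}. N x)"
    by (auto simp: N_def)
  ultimately have "card (color_class n \<alpha> c) \<le> card (SIGMA x:{..<n}. N x)"
    by (meson surj_card_le)
  also have "\<dots> = (\<Sum>x<n. card (N x))"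
    by (simp add: N_def)
  also have "\<dots> \<le> n * r"
    using sum_bounded_above[of "{..<n}" "\<lambda>x. card (N x)" r] N_le by simp
  finally show False
    using assms by simp
qed

text \<open>The constant \<open>r\<close> is a Ramsey number and depends on \<open>k\<close> only,
  so the threshold \<open>n * r\<close> grows linearly while the number of edges is
  quadratic.\<close>

lemma two_colored_cone_if_large_color_classes:
  "\<exists>r. \<forall>n \<alpha>. (\<forall>c. card (color_class n \<alpha> c) > n * r) \<longrightarrow> two_colored_cone n \<alpha> k"
proof -
  \<comment> \<open>This size lets a clique of either color serve as \<open>S\<close> or as
    \<open>T\<close> in the lemma on two large cliques.\<close>
  define K where "K = k * k + k + 1"
  obtain r where r: "\<And>V E. finite (V :: nat set) \<Longrightarrow> card V \<ge> r \<Longrightarrow>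
      \<exists>R \<subseteq> V. card R = K \<and> clique R E \<or> card R = k \<and> indep R E"
    using ramsey2[of K k, where 'a = nat] by blast
  have "two_colored_cone n \<alpha> k" if large: "\<And>c. card (color_class n \<alpha> c) > n * r" for n \<alpha>
  proof (rule ccontr)
    assume no_cone: "\<not> ?thesis"
    have clique_ex: "\<exists>S \<subseteq> {..<n}. card S = K \<and> clique S {e. \<alpha> e = c}" if "c \<noteq> d" for c d
    proof -
      obtain x where x: "x < n" "card {y \<in> {..<n} - {x}. \<alpha> {x, y} = c} \<ge> r"
        using large_color_class_large_neighborhood[OF large] by blast
      obtain R where R: "R \<subseteq> {y \<in> {..<n} - {x}. \<alpha> {x, y} = c}"
        "card R = K \<and> clique R {e. \<alpha> e = c} \<or> card R = k \<and> indep R {e. \<alpha> e = c}"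
        using r[OF _ x(2), of "{e. \<alpha> e = c}"] by auto
      \<comment> \<open>With two colors, a set independent in color \<open>c\<close> is a clique in
        color \<open>d\<close>; as \<open>x\<close> is joined to it in color \<open>c\<close>, it
        would be the base of a cone.\<close>
      have "\<not> (card R = k \<and> indep R {e. \<alpha> e = c})"
      proof
        assume *: "card R = k \<and> indep R {e. \<alpha> e = c}"
        then have "clique R {e. \<alpha> e = d}"
          using color_neq_trans \<open>c \<noteq> d\<close> unfolding clique_def indep_def by blast
        then show False
          using two_colored_coneI[of x n R k \<alpha> d] x(1) R(1) * no_cone \<open>c \<noteq> d\<close> by auto
      qed
      then show ?thesis
        using R by blast
    qed
    obtain S T where "S \<subseteq> {..<n}" "card S = K" "clique S {e. \<alpha> e = Red}"
      "T \<subseteq> {..<n}" "card T = K" "clique T {e. \<alpha> e = Blue}"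
      using clique_ex[of Red Blue] clique_ex[of Blue Red] by auto
    then show False
      using two_colored_cone_if_large_cliques[of S n k \<alpha> Red T Blue] no_cone
      by (simp add: K_def)
  qed
  then show ?thesis
    by blast
qed

lemma contains_balanced_copy_if_two_colored_cone:
  assumes "simple_graph V E" "v \<in> V" "card E = 2 * vertex_degree E v"
    and "two_colored_cone n \<alpha> (card (V - {v}))"
  shows "contains_balanced_copy n \<alpha> V E"
proof -
  have "finite V" and E: "E \<subseteq> [V]\<^bsup>2\<^esup>"
    using assms(1) by (auto simp: simple_graph_def)
  then have "finite E"
    using finite_imp_finite_nsets finite_subset by blast
  obtain c x A where A: "x < n" "A \<subseteq> {..<n}" "x \<notin> A" "card A = card (V - {v})"
    "clique A {e. \<alpha> e = c}" "\<And>a. a \<in> A \<Longrightarrow> \<alpha> {x, a} \<noteq> c"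
    using assms(4) unfolding two_colored_cone_def by blast
  have "finite A"
    using A(2) finite_subset by blast
  then obtain g where g: "bij_betw g (V - {v}) A"
    using A(4) \<open>finite V\<close> by (metis finite_Diff finite_same_card_bij)
  define f where "f = g(v := x)"
  have fv: "f v = x" and fA: "\<And>u. u \<in> V \<Longrightarrow> u \<noteq> v \<Longrightarrow> f u \<in> A"
    using g by (auto simp: f_def bij_betw_def)
  have "bij_betw f (V - {v}) A"
    using g by (subst bij_betw_cong[of _ f g]) (auto simp: f_def)
  then have f: "bij_betw f V (insert x A)"
    using bij_betw_combine[of f "V - {v}" A "{v}" "{x}"] A(3) assms(2) fv
    by (simp add: insert_absorb bij_betw_def)
  define F where "F = (`) f ` E"
  have inj: "inj_on f V"
    using f by (simp add: bij_betw_def)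
  have E_Pow: "E \<subseteq> Pow V"
    using E by (auto simp: nsets_def)
  \<comment> \<open>Injectivity on vertex sets serves twice: it makes \<open>f\<close> reflect
    edges, and it preserves the number of edges with a given property.\<close>
  have inj': "inj_on ((`) f) (Pow V)"
    using inj by (simp add: inj_on_image_Pow)
  have F: "F \<subseteq> [insert x A]\<^bsup>2\<^esup>"
  proof
    fix e' assume "e' \<in> F"
    then obtain e where e: "e \<in> E" "e' = f ` e"
      by (auto simp: F_def)
    obtain a b where ab: "e = {a, b}" "a \<in> V" "b \<in> V" "a \<noteq> b"
      using subsetD[OF E e(1)] by (rule nsets2_E)
    have "f a \<noteq> f b"
      using inj_on_contraD[OF inj ab(4,2,3)] .
    then show "e' \<in> [insert x A]\<^bsup>2\<^esup>"
      using bij_betwE[OF f] e(2) ab by simp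
  qed
  have W: "insert x A \<subseteq> {..<n}"
    using A by auto
  have sub: "subgraph (insert x A) F {..<n} (complete_edges n)"
    using F W \<open>finite A\<close> nsets_mono[OF W, of 2]
    by (auto simp: subgraph_def simple_graph_def complete_edges_def)
  have "{u, w} \<in> E \<longleftrightarrow> {f u, f w} \<in> F" if "u \<in> V" "w \<in> V" for u w
    using inj_on_image_mem_iff[OF inj', of "{u, w}" E] that E_Pow by (simp add: F_def)
  then have iso: "graph_isomorphic V E (insert x A) F"
    unfolding graph_isomorphic_def using f by blast
  \<comment> \<open>The color of an image edge depends only on whether the edge contains
    \<open>v\<close>. The two colors thus split the copy into the edges at \<open>v\<close> and the
    others, which are equally many.\<close>
  have color: "\<alpha> (f ` e) = c \<longleftrightarrow> v \<notin> e" if e: "e \<in> E" for e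
  proof -
    obtain a b where ab: "e = {a, b}" "a \<in> V" "b \<in> V" "a \<noteq> b"
      using subsetD[OF E e] by (rule nsets2_E)
    consider "a = v" | "b = v" | "a \<noteq> v" "b \<noteq> v"
      by blast
    then show ?thesis
    proof cases
      case 1
      then show ?thesis
        using A(6)[OF fA[OF ab(3)]] fv ab by simp
    next
      case 2
      then show ?thesis
        using A(6)[OF fA[OF ab(2)]] fv ab by (simp add: insert_commute)
    next
      case 3
      have "f a \<noteq> f b"
        using inj_on_contraD[OF inj ab(4,2,3)] .
      then have "\<alpha> {f a, f b} = c"
        using A(5) fA[OF ab(2) 3(1)] fA[OF ab(3) 3(2)] by (simp add: clique_def)
      then show ?thesis
        using ab(1) 3 by simp
    qed
  qed
  have card_F: "card {e \<in> F. P e} = card {e \<in> E. P (f ` e)}" for P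
  proof -
    have "{e \<in> F. P e} = (`) f ` {e \<in> E. P (f ` e)}"
      by (auto simp: F_def)
    moreover have "inj_on ((`) f) {e \<in> E. P (f ` e)}"
      using inj' by (rule inj_on_subset) (use E_Pow in auto)
    ultimately show ?thesis
      by (simp add: card_image)
  qed
  have at_v: "card {e \<in> E. v \<in> e} = vertex_degree E v"
    by (simp add: vertex_degree_def)
  moreover have "card E = card {e \<in> E. v \<in> e} + card {e \<in> E. v \<notin> e}"
    using \<open>finite E\<close> by (subst card_Un_disjoint[symmetric]) (auto intro: arg_cong[where f = card])
  ultimately have off_v: "card {e \<in> E. v \<notin> e} = vertex_degree E v"
    using assms(3) by simp
  have "card {e \<in> F. \<alpha> e = d} = vertex_degree E v" for d
  proof (cases "d = c")
    case True
    have "{e \<in> E. \<alpha> (f ` e) = d} = {e \<in> E. v \<notin> e}"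
      using color True by blast
    then show ?thesis
      using card_F[of "\<lambda>e. \<alpha> e = d"] off_v by simp
  next
    case False
    have "{e \<in> E. \<alpha> (f ` e) = d} = {e \<in> E. v \<in> e}"
      using color False color_neq_trans[of _ c d] by (metis (lifting))
    then show ?thesis
      using card_F[of "\<lambda>e. \<alpha> e = d"] at_v by simp
  qed
  then have "\<bar>int (card {e \<in> F. \<alpha> e = Red}) - int (card {e \<in> F. \<alpha> e = Blue})\<bar> \<le> 1"
    by simp
  moreover have "F = {e \<in> F. \<alpha> e = Red} \<union> {e \<in> F. \<alpha> e = Blue}"
  proof -
    have "\<alpha> e = Red \<or> \<alpha> e = Blue" for e
      by (cases "\<alpha> e") auto
    then show ?thesis
      by blast
  qed
  moreover have "{e \<in> F. \<alpha> e = Red} \<inter> {e \<in> F. \<alpha> e = Blue} = {}"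
    "\<forall>e\<in>{e \<in> F. \<alpha> e = Red}. \<alpha> e = Red" "\<forall>e\<in>{e \<in> F. \<alpha> e = Blue}. \<alpha> e = Blue"
    by auto
  ultimately show ?thesis
    unfolding contains_balanced_copy_def using sub iso by (intro exI conjI)
qed

text \<open>From n - 1 \<ge> 4r + 4 follows n(n - 1) \<ge> 4(nr + n), so halving twice, even with
  rounding down, leaves at least nr + n, and n is positive.\<close>

lemma linear_less_half_choose_two:
  assumes "n \<ge> 4 * r + 5"
  shows "n * r < (n choose 2) div 2"
proof -
  have "n * (4 * r + 4) \<le> n * (n - 1)"
    using assms by (intro mult_le_mono2) simp
  then have "4 * (n * r) + 4 * n \<le> n * (n - 1)"
    by (simp add: algebra_simps)
  then show ?thesis
    using assms unfolding choose_two by linarith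
qed

theorem proposition5:
  fixes V :: "'a set" and E :: "'a set set" and v :: 'a
  assumes "simple_graph V E"
    and "v \<in> V"
    and "real (vertex_degree E v) = real (card E) / 2"
  shows "balanceable V E"
proof -
  have deg: "card E = 2 * vertex_degree E v"
    using assms(3) by linarith
  obtain r where r: "\<And>n \<alpha>. (\<And>c. card (color_class n \<alpha> c) > n * r) \<Longrightarrow>
      two_colored_cone n \<alpha> (card (V - {v}))"
    using two_colored_cone_if_large_color_classes by blast
  have "contains_balanced_copy n \<alpha> V E"
    if "card (color_class n \<alpha> Red) > n * r" "card (color_class n \<alpha> Blue) > n * r" for n \<alpha>
  proof (rule contains_balanced_copy_if_two_colored_cone[OF assms(1,2) deg], rule r)
    fix c show "card (color_class n \<alpha> c) > n * r"
      using that by (cases c) auto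
  qed
  \<comment> \<open>The witnesses are \<open>4 * r + 5\<close> for \<open>n0\<close> and
    \<open>n * r\<close> for \<open>m\<close>.\<close>
  then show ?thesis
    unfolding balanceable_def using linear_less_half_choose_two by blast
qed

end
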